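(* Let $m^\star$ be a monotone non-increasing probability density on $[0,\infty)$ with uniform-mixture representation $m^\star(x)=\int_0^\infty\mathsf{Unif}(x\mid 0,u)\,P^\star(du)$ and distribution function $M^\star$. Fix $0<\ell<L<\infty$, let $\mathbb{U}=[\ell,L]$, and let $m^{\star L}(x)=m^\star(x)\,1_{[0,L]}(x)/M^\star(L)$. For probability measures $P$ on $\mathbb{U}$, let $m_P(x)=\int_{\mathbb{U}}\mathsf{Unif}(x\mid 0,u)\,P(du)$, $x\in[0,L]$, and suppose $K(m^{\star L},m_P)<\infty$ for at least one such $P$. Then the unique minimizer, $P^\dagger=P^{\dagger\,\ell,L}$, of the Kullback--Leibler divergence $P\mapsto K(m^{\star L},m_P)$ over probability measures $P$ on $\mathbb{U}$ is given by $$P^\dagger=a_\ell\,\delta_{\{\ell\}}+a_{\mathbb{U}}\,P^\star|_{\mathbb{U}}+a_L\,\delta_{\{L\}},$$ where $\delta_{\{t\}}$ is the Dirac point mass at $t$, $P^\star|_{\mathbb{U}}$ is $P^\star$ restricted to $\mathbb{U}=[\ell,L]$, and the coefficients are $$a_\ell=\frac{P^\star([0,\ell])}{M^\star(L)},\qquad a_{\mathbb{U}}=\frac{P^\star([0,L])}{M^\star(L)},\qquad a_L=\frac{L\,m^\star(L)}{M^\star(L)}.$$ Then the best approximation of $m^{\star L}$ among the mixtures $m_P$ is $m^\dagger=m_{P^\dagger}$, given by $$m^\dagger(x)=a_\ell\,\mathsf{Unif}(x\mid 0,\ell)+a_{\mathbb{U}}\int_{\mathbb{U}}\mathsf{Unif}(x\mid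 0,u)\,P^\star(du)+a_L\,\mathsf{Unif}(x\mid 0,L).$$
   Context: $\mathsf{Unif}(x\mid 0,u)=u^{-1}1_{[0,u]}(x)$ is the uniform kernel density. Every monotone non-increasing density $m^\star$ on $[0,\infty)$ can be written as $m^\star(x)=\int_0^\infty\mathsf{Unif}(x\mid0,u)\,P^\star(du)$ for some probability measure $P^\star$ on $[0,\infty)$. The Kullback--Leibler divergence is $K(f,g)=\int\log\{f(x)/g(x)\}\,f(x)\,dx$.
   Formalization: P*|_U (and P*(du) in the formula for m†) is taken as P* restricted to the open interval (ℓ,L) and divided by P*([0,L]), since with the displayed coefficients the plain or normalized restriction to [ℓ,L] need not give total mass 1 and atoms at ℓ, L would be counted twice. *)

theory Defs
  imports "HOL-Probability.Probability"
begin

text \<open>Densities are \<open>ennreal\<close>-valued, because a monotone density may be infinite at the origin.\<close>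

definition prob_density_on :: "real set \<Rightarrow> (real \<Rightarrow> ennreal) \<Rightarrow> bool" where
  "prob_density_on S f \<longleftrightarrow>
     (\<lambda>x. f x * indicator S x) \<in> borel_measurable lborel \<and> (\<integral>\<^sup>+x\<in>S. f x \<partial>lborel) = 1"

text \<open>Probability measures on \<open>S\<close> are Borel probability measures on the real line that are
  concentrated on \<open>S\<close>, so that they can be compared with each other as measures on one space.\<close>

definition prob_measure_on :: "real set \<Rightarrow> real measure \<Rightarrow> bool" where
  "prob_measure_on S P \<longleftrightarrow> prob_space P \<and> sets P = sets borel \<and> emeasure P (- S) = 0"

definition Unif :: "real \<Rightarrow> real \<Rightarrow> ennreal" where
  "Unif u x = indicator {0..u} x / ennreal u"

definition unif_mixture :: "real set \<Rightarrow> real measure \<Rightarrow> real \<Rightarrow> ennreal" where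
  "unif_mixture S P x = (\<integral>\<^sup>+u\<in>S. Unif u x \<partial>P)"

definition distr_fun :: "(real \<Rightarrow> ennreal) \<Rightarrow> real \<Rightarrow> ennreal" where
  "distr_fun m t = (\<integral>\<^sup>+x\<in>{0..t}. m x \<partial>lborel)"

definition truncated :: "(real \<Rightarrow> ennreal) \<Rightarrow> real \<Rightarrow> real \<Rightarrow> ennreal" where
  "truncated m L x = m x * indicator {0..L} x / distr_fun m L"

text \<open>The Kullback--Leibler divergence takes values in \<open>ereal\<close>. The library's
  \<open>KL_divergence\<close> is a Bochner integral and returns 0 when the integrand is not integrable, so
  an infinite divergence would look minimal. The conventions for the integrand are
  \<open>0 * log (0 / b) = 0\<close> and \<open>a * log (a / 0) = \<infinity>\<close> for \<open>a > 0\<close>; the value at points where a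
  density is infinite is irrelevant, since these form a null set. For probability densities the
  negative part always has a finite integral, so the difference below is never
  \<open>\<infinity> - \<infinity>\<close>.\<close>

definition KL_integrand :: "ennreal \<Rightarrow> ennreal \<Rightarrow> ereal" where
  "KL_integrand a b =
     (if a = 0 then 0 else if b = 0 then \<infinity>
      else ereal (ln (enn2real a / enn2real b) * enn2real a))"

definition KL :: "(real \<Rightarrow> ennreal) \<Rightarrow> (real \<Rightarrow> ennreal) \<Rightarrow> ereal" where
  "KL f g =
     enn2ereal (\<integral>\<^sup>+x. e2ennreal (KL_integrand (f x) (g x)) \<partial>lborel)
     - enn2ereal (\<integral>\<^sup>+x. e2ennreal (- KL_integrand (f x) (g x)) \<partial>lborel)"

text \<open>The restriction of a mixing measure to \<open>{l..L}\<close>, read so that the weights \<open>a\<^sub>l\<close>, \<open>a\<^sub>U\<close>,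
  \<open>a\<^sub>L\<close> of the minimizer produce a probability measure for every mixing measure \<open>P\<close>:

  \<^item> It is the restriction of the conditional law of \<open>P\<close> given \<open>{0..L}\<close>. The weight
    \<open>a\<^sub>U = P {0..L} / M L\<close> cancels exactly this normalization, whereas neither the restriction of
    \<open>P\<close> itself nor its normalization to a probability measure on \<open>{l..L}\<close> would in general make
    the total mass 1.
  \<^item> Atoms of \<open>P\<close> at the endpoints are left out: \<open>a\<^sub>l = P {0..l} / M L\<close> already contains an
    atom at \<open>l\<close>, and \<open>a\<^sub>L = L * m L / M L\<close> an atom at \<open>L\<close>, since the kernels \<open>Unif u\<close> have
    closed support \<open>{0..u}\<close>. Without atoms at \<open>l\<close> and \<open>L\<close> this makes no difference, see
    \<open>emeasure_restr_closed\<close>.\<close>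

definition restr :: "real measure \<Rightarrow> real \<Rightarrow> real \<Rightarrow> real measure" where
  "restr P l L = density (uniform_measure P {0..L}) (indicator {l<..<L})"

definition endpoint_mixture ::
  "ennreal \<Rightarrow> real \<Rightarrow> ennreal \<Rightarrow> real measure \<Rightarrow> ennreal \<Rightarrow> real \<Rightarrow> real measure" where
  "endpoint_mixture a l b Q c L =
     measure_of UNIV (sets borel)
       (\<lambda>A. a * emeasure (return borel l) A + b * emeasure Q A + c * emeasure (return borel L) A)"

lemma sets_endpoint_mixture [simp]: "sets (endpoint_mixture a l b Q c L) = sets borel"
  using sets.sigma_sets_eq[of "borel :: real measure"]
  by (simp add: endpoint_mixture_def sets_measure_of)

lemma emeasure_endpoint_mixture:
  assumes Q: "sets Q = sets borel" and A: "A \<in> sets borel"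
  shows "emeasure (endpoint_mixture a l b Q c L) A =
           a * indicator A l + b * emeasure Q A + c * indicator A L"
proof -
  let ?f = "\<lambda>A. a * emeasure (return borel l) A + b * emeasure Q A + c * emeasure (return borel L) A"
  have sig: "sigma_algebra UNIV (sets (borel :: real measure))"
    using sets.sigma_algebra_axioms[of "borel :: real measure"] by simp
  have ca: "countably_additive (sets borel) ?f"
    unfolding countably_additive_def
  proof (intro allI impI)
    fix F :: "nat \<Rightarrow> real set"
    assume F: "range F \<subseteq> sets borel" "disjoint_family F" "\<Union> (range F) \<in> sets borel"
    have "(\<Sum>i. ?f (F i)) =
        (\<Sum>i. a * emeasure (return borel l) (F i)) + (\<Sum>i. b * emeasure Q (F i))
        + (\<Sum>i. c * emeasure (return borel L) (F i))"
      by (simp add: suminf_add[symmetric])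
    also have "\<dots> = ?f (\<Union> (range F))"
    proof -
      have "(\<Sum>i. emeasure M (F i)) = emeasure M (\<Union> (range F))"
        if "sets M = sets borel" for M :: "real measure"
        using F that by (intro suminf_emeasure) auto
      from this[OF Q] this[of "return borel l"] this[of "return borel L"]
      show ?thesis by (simp only: ennreal_suminf_cmult sets_return)
    qed
    finally show "(\<Sum>i. ?f (F i)) = ?f (\<Union> (range F))" .
  qed
  have "emeasure (endpoint_mixture a l b Q c L) A = ?f A"
    unfolding endpoint_mixture_def
    by (rule emeasure_measure_of_sigma[OF sig _ ca A]) (simp add: positive_def)
  then show ?thesis using A by simp
qed

lemma sets_restr [simp]: "sets (restr P l L) = sets P"
  by (simp add: restr_def)

lemma emeasure_restr:
  assumes P: "sets P = sets borel" and A: "A \<in> sets borel" and "0 \<le> l"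
  shows "emeasure (restr P l L) A = emeasure P (A \<inter> {l<..<L}) / emeasure P {0..L}"
proof -
  have "emeasure (restr P l L) A = emeasure (uniform_measure P {0..L}) (A \<inter> {l<..<L})"
    using P A unfolding restr_def
    by (subst emeasure_restricted) (auto simp: Int_commute)
  also have "\<dots> = emeasure P ({0..L} \<inter> (A \<inter> {l<..<L})) / emeasure P {0..L}"
    using P A by (intro emeasure_uniform_measure) auto
  also have "{0..L} \<inter> (A \<inter> {l<..<L}) = A \<inter> {l<..<L}"
    using \<open>0 \<le> l\<close> by auto
  finally show ?thesis .
qed

lemma emeasure_restr_closed:
  assumes P: "sets P = sets borel" and A: "A \<in> sets borel" and "0 \<le> l"
    and "emeasure P {l} = 0" "emeasure P {L} = 0"
  shows "emeasure (restr P l L) A = emeasure P (A \<inter> {l..L}) / emeasure P {0..L}"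
proof -
  have N: "emeasure P ({l} \<union> {L}) = 0"
    using assms by (subst emeasure_Un_null_set) (simp_all add: null_sets_def)
  have "emeasure P (A \<inter> {l<..<L}) = emeasure P (A \<inter> {l..L})"
  proof (rule antisym)
    have "emeasure P (A \<inter> {l..L}) \<le> emeasure P ((A \<inter> {l<..<L}) \<union> ({l} \<union> {L}))"
      using P A by (intro emeasure_mono) auto
    also have "\<dots> = emeasure P (A \<inter> {l<..<L})"
      using P A N by (intro emeasure_Un_null_set) (simp_all add: null_sets_def)
    finally show "emeasure P (A \<inter> {l..L}) \<le> emeasure P (A \<inter> {l<..<L})" .
  next
    show "emeasure P (A \<inter> {l<..<L}) \<le> emeasure P (A \<inter> {l..L})"
      using P A by (intro emeasure_mono) auto
  qed
  then show ?thesis using emeasure_restr[OF P A \<open>0 \<le> l\<close>] by simp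
qed

end

theory Submission
  imports Defs
begin

text \<open>Every mixture \<open>m\<^sub>P\<close> with \<open>P\<close> on \<open>{l..L}\<close> is constant on \<open>{0..l}\<close>. The mixture
  \<open>m\<^sub>\<dagger>\<close> of the proposed minimizer equals the truncated density \<open>f\<close> on \<open>{l<..L}\<close> and, both
  having mass 1, its constant value on \<open>{0..l}\<close> is the average of \<open>f\<close> there. Hence \<open>f\<close> and
  \<open>m\<^sub>\<dagger>\<close> integrate \<open>ln (m\<^sub>\<dagger> / m\<^sub>P)\<close> to the same value, which gives the Pythagorean identity
  \<open>K(f, m\<^sub>P) = K(f, m\<^sub>\<dagger>) + K(m\<^sub>\<dagger>, m\<^sub>P)\<close>. Since \<open>K(f, m\<^sub>\<dagger>)\<close> is finite, the minimum is
  attained exactly when \<open>m\<^sub>P = m\<^sub>\<dagger>\<close> almost everywhere, and a mixture determines its mixing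
  measure because on the positive half-line it is the tail function of the measure
  \<open>P(du) / u\<close>.\<close>

section \<open>The divergence as an integral of a nonnegative Bregman term\<close>

text \<open>Between probability densities, the extra terms \<open>- a + b\<close> integrate to 0 but make the
  integrand of the divergence nonnegative, so that \<open>ennreal\<close> integrals suffice.\<close>

definition bregman :: "ennreal \<Rightarrow> ennreal \<Rightarrow> ennreal" where
  "bregman a b =
     (if a = 0 then b else if b = 0 then \<infinity>
      else ennreal (ln (enn2real a / enn2real b) * enn2real a - enn2real a + enn2real b))"

text \<open>This is ln t \<le> t - 1 at t = B / A, multiplied by A.\<close>

lemma bregman_real_nonneg:
  fixes A B :: real
  assumes "0 < A" "0 < B"
  shows "0 \<le> ln (A / B) * A - A + B"
proof -
  have "- ln (A / B) \<le> B / A - 1"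
    using ln_le_minus_one[of "B / A"] assms by (simp add: ln_div)
  then have "- ln (A / B) * A \<le> (B / A - 1) * A"
    using assms by (intro mult_right_mono) auto
  also have "\<dots> = B - A" using assms by (simp add: field_simps)
  finally show ?thesis by simp
qed

lemma bregman_refl: "a < \<infinity> \<Longrightarrow> bregman a a = 0"
  by (cases a) (auto simp: bregman_def)

text \<open>Equality in ln t \<le> t - 1 forces t = 1. Infinite arguments are excluded because
  \<open>enn2real\<close> sends them to 0.\<close>

lemma bregman_eq_0D:
  assumes "bregman a b = 0" "a < \<infinity>" "b < \<infinity>"
  shows "a = b"
proof (cases "a = 0 \<or> b = 0")
  case True
  then show ?thesis using assms by (auto simp: bregman_def split: if_splits)
next
  case False
  obtain A B where AB: "a = ennreal A" "b = ennreal B" "A > 0" "B > 0"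
    using assms False by (cases a; cases b) (auto simp: less_le)
  have "ln (A / B) * A - A + B \<le> 0"
    using assms(1) AB by (simp add: bregman_def ennreal_eq_0_iff)
  then have "ln (A / B) * A - A + B = 0"
    using bregman_real_nonneg[of A B] AB by linarith
  then have "ln (B / A) = B / A - 1"
    using AB by (simp add: ln_div field_simps)
  then have "B / A = 1"
    using AB by (intro ln_eq_minus_one) auto
  then show ?thesis using AB by simp
qed

lemma measurable_bregman [measurable]:
  assumes [measurable]: "f \<in> borel_measurable M" "g \<in> borel_measurable M"
  shows "(\<lambda>x. bregman (f x) (g x)) \<in> borel_measurable M"
  unfolding bregman_def by measurable

lemma measurable_KL_integrand [measurable]:
  assumes [measurable]: "f \<in> borel_measurable M" "g \<in> borel_measurable M"
  shows "(\<lambda>x. KL_integrand (f x) (g x)) \<in> borel_measurable M"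
  unfolding KL_integrand_def by measurable

text \<open>Nonnegativity of the Bregman term gives - A ln (A / B) \<le> B - A \<le> B. This bounds
  the subtracted integral in \<open>KL\<close> by the mass of the second density, so it is
  finite.\<close>

lemma KL_integrand_neg_le:
  assumes "a < \<infinity>" "b < \<infinity>"
  shows "e2ennreal (- KL_integrand a b) \<le> b"
proof (cases "a = 0 \<or> b = 0")
  case True
  then show ?thesis by (auto simp: KL_integrand_def e2ennreal_neg)
next
  case False
  obtain A B where AB: "a = ennreal A" "b = ennreal B" "A > 0" "B > 0"
    using assms False by (cases a; cases b) (auto simp: less_le)
  then show ?thesis
    using bregman_real_nonneg[of A B] by (auto simp: KL_integrand_def e2ennreal_ereal intro!: ennreal_leI)
qed

text \<open>Positive minus negative part is the integrand, and \<open>bregman\<close> adds - a + b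
  to it. Moving every subtracted term to the other side makes this an identity in
  \<open>ennreal\<close> that also covers an infinite integrand.\<close>

lemma KL_integrand_bregman:
  assumes "a < \<infinity>" "b < \<infinity>"
  shows "e2ennreal (KL_integrand a b) + b = e2ennreal (- KL_integrand a b) + (a + bregman a b)"
proof (cases "a = 0 \<or> b = 0")
  case True
  then show ?thesis by (auto simp: KL_integrand_def bregman_def e2ennreal_neg)
next
  case False
  obtain A B where AB: "a = ennreal A" "b = ennreal B" "A > 0" "B > 0"
    using assms False by (cases a; cases b) (auto simp: less_le)
  let ?t = "ln (A / B) * A"
  have "0 \<le> ?t - A + B" using bregman_real_nonneg[of A B] AB by simp
  then show ?thesis
    using AB by (cases "0 \<le> ?t")
      (auto simp: KL_integrand_def bregman_def e2ennreal_ereal ennreal_plus[symmetric] ennreal_neg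
            simp del: ennreal_plus)
qed

lemma AE_finite_of_nn_integral:
  assumes "f \<in> borel_measurable M" "(\<integral>\<^sup>+x. f x \<partial>M) < \<infinity>"
  shows "AE x in M. f x < (\<infinity>::ennreal)"
  using nn_integral_PInf_AE[of f M] assms by (auto simp: top.not_eq_extremum)

text \<open>Integrating \<open>KL_integrand_bregman\<close> gives
  \<open>?p + 1 = ?n + (1 + ?d)\<close>, and the two masses cancel. As \<open>?n\<close> is finite
  it can be subtracted even if \<open>?p\<close> and \<open>?d\<close> are infinite.\<close>

lemma KL_eq_bregman:
  assumes [measurable]: "f \<in> borel_measurable lborel" "g \<in> borel_measurable lborel"
    and f: "(\<integral>\<^sup>+x. f x \<partial>lborel) = 1" and g: "(\<integral>\<^sup>+x. g x \<partial>lborel) = 1"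
  shows "KL f g = enn2ereal (\<integral>\<^sup>+x. bregman (f x) (g x) \<partial>lborel)"
proof -
  let ?p = "\<integral>\<^sup>+x. e2ennreal (KL_integrand (f x) (g x)) \<partial>lborel"
  let ?n = "\<integral>\<^sup>+x. e2ennreal (- KL_integrand (f x) (g x)) \<partial>lborel"
  let ?d = "\<integral>\<^sup>+x. bregman (f x) (g x) \<partial>lborel"
  have fin: "AE x in lborel. f x < \<infinity>" "AE x in lborel. g x < \<infinity>"
    using f g by (intro AE_finite_of_nn_integral; simp)+
  have "?n \<le> (\<integral>\<^sup>+x. g x \<partial>lborel)"
    by (intro nn_integral_mono_AE, use fin in eventually_elim) (rule KL_integrand_neg_le)
  then have n: "?n < \<infinity>" using g by (simp add: le_less_trans)
  have "?p + (\<integral>\<^sup>+x. g x \<partial>lborel)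
      = (\<integral>\<^sup>+x. e2ennreal (KL_integrand (f x) (g x)) + g x \<partial>lborel)"
    by (subst nn_integral_add) auto
  also have "\<dots> = (\<integral>\<^sup>+x. e2ennreal (- KL_integrand (f x) (g x)) + (f x + bregman (f x) (g x)) \<partial>lborel)"
    by (intro nn_integral_cong_AE, use fin in eventually_elim) (rule KL_integrand_bregman)
  also have "\<dots> = ?n + ((\<integral>\<^sup>+x. f x \<partial>lborel) + ?d)"
    by (simp add: nn_integral_add)
  finally have "?p + 1 = (?n + ?d) + 1" using f g by (simp add: ac_simps)
  then have "?p = ?n + ?d" by simp
  then show ?thesis
    unfolding KL_def using n
    by (cases ?n; cases ?d) (auto simp: plus_ennreal.rep_eq)
qed

section \<open>The Pythagorean identity\<close>

text \<open>The identity comes from \<open>bregman a d = bregman a c + bregman c d + (a - c) * ln (c / d)\<close>. The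
  last term is split into positive and negative parts, moved to the two sides, because
  \<open>ennreal\<close> has no negative values.\<close>

lemma bregman_pythagoras_pointwise:
  assumes "a < \<infinity>" "0 < c" "0 < d"
  shows "bregman a (ennreal d) + (ennreal c * ennreal (ln (c / d)) + a * ennreal (- ln (c / d)))
       = bregman a (ennreal c) + bregman (ennreal c) (ennreal d)
         + (a * ennreal (ln (c / d)) + ennreal c * ennreal (- ln (c / d)))"
proof -
  define k where "k = ln (c / d)"
  have cd: "0 \<le> k * c - c + d" using bregman_real_nonneg assms unfolding k_def by blast
  obtain A where A: "a = ennreal A" "0 \<le> A" using assms by (cases a) auto
  have b: "bregman (ennreal c) (ennreal d) = ennreal (k * c - c + d)"
    using assms by (simp add: bregman_def k_def)
  \<comment> \<open>X and Y are the real values of the two terms with first argument a. Their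
    difference is k * A + d - c both for A = 0 and for A > 0, so the branches of
    \<open>bregman\<close> need no further distinction.\<close>
  obtain X Y where XY: "0 \<le> X" "0 \<le> Y" "X = Y + k * A + d - c"
    "bregman a (ennreal d) = ennreal X" "bregman a (ennreal c) = ennreal Y"
  proof (cases "A = 0")
    case True
    then show ?thesis using that[of d c] A assms by (simp add: bregman_def)
  next
    case False
    then have "0 < A" using A by simp
    then have "ln (A / d) * A = ln (A / c) * A + k * A"
      using assms by (simp add: ln_div k_def algebra_simps)
    then show ?thesis
      using that[of "ln (A / d) * A - A + d" "ln (A / c) * A - A + c"] \<open>0 < A\<close> A assms
        bregman_real_nonneg[of A c] bregman_real_nonneg[of A d]
      by (simp add: bregman_def)
  qed
  \<comment> \<open>According to the sign of k, one of \<open>ennreal k\<close> and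
    \<open>ennreal (- k)\<close> is 0, which leaves a single equation between nonnegative
    reals.\<close>
  show ?thesis
  proof (cases "0 \<le> k")
    case True
    then have "ennreal (X + c * k) = ennreal (Y + (k * c - c + d) + A * k)"
      by (intro arg_cong[of _ _ ennreal]) (simp add: XY(3) algebra_simps)
    then show ?thesis
      unfolding XY(4,5) b A(1) k_def[symmetric] using True XY cd A assms
      by (simp add: ennreal_plus ennreal_mult ennreal_neg del: add_uminus_conv_diff)
  next
    case False
    then have "ennreal (X + A * - k) = ennreal (Y + (k * c - c + d) + c * - k)"
      by (intro arg_cong[of _ _ ennreal]) (simp add: XY(3) algebra_simps)
    moreover have "ennreal (X + A * - k) = ennreal X + ennreal A * ennreal (- k)"
      "ennreal (Y + (k * c - c + d) + c * - k) = ennreal Y + ennreal (k * c - c + d) + ennreal c * ennreal (- k)"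
      using False XY(1,2) cd A assms
      by (simp_all only: ennreal_plus ennreal_mult add_nonneg_nonneg mult_nonneg_nonneg
            neg_0_le_iff_le linear less_imp_le)
    ultimately show ?thesis
      unfolding XY(4,5) b k_def[symmetric] using False by (simp only: A(1)) (simp add: ennreal_neg)
  qed
qed

text \<open>Off C the middle term is \<open>bregman (f x) (f x)\<close>, which vanishes almost
  everywhere. On C the logarithm ln (c / d) is constant, so the cross terms depend on f and g only
  through their masses on C; these agree and are finite, hence the cross terms cancel.\<close>

lemma bregman_pythagoras:
  assumes [measurable]: "f \<in> borel_measurable M" "g \<in> borel_measurable M" "h \<in> borel_measurable M"
    "C \<in> sets M"
    and f: "(\<integral>\<^sup>+x. f x \<partial>M) < \<infinity>"
    and outside: "\<And>x. x \<in> space M \<Longrightarrow> x \<notin> C \<Longrightarrow> f x = g x"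
    and g: "\<And>x. x \<in> C \<Longrightarrow> g x = ennreal c" and h: "\<And>x. x \<in> C \<Longrightarrow> h x = ennreal d"
    and cd: "0 < c" "0 < d"
    and C: "(\<integral>\<^sup>+x\<in>C. f x \<partial>M) = (\<integral>\<^sup>+x\<in>C. g x \<partial>M)"
  shows "(\<integral>\<^sup>+x. bregman (f x) (h x) \<partial>M)
       = (\<integral>\<^sup>+x. bregman (f x) (g x) \<partial>M) + (\<integral>\<^sup>+x. bregman (g x) (h x) \<partial>M)"
proof -
  let ?p = "ennreal (ln (c / d))" and ?n = "ennreal (- ln (c / d))"
  let ?F = "\<integral>\<^sup>+x\<in>C. f x \<partial>M"
  have fin: "AE x in M. f x < \<infinity>"
    using f by (intro AE_finite_of_nn_integral; simp)+
  have "?F \<le> (\<integral>\<^sup>+x. f x \<partial>M)"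
    by (intro nn_integral_mono) (auto simp: indicator_def)
  then have F: "?F < \<infinity>" using f by (rule le_less_trans)
  have "(\<integral>\<^sup>+x. bregman (f x) (h x) \<partial>M) + (?F * ?p + ?F * ?n)
     = (\<integral>\<^sup>+x. bregman (f x) (h x) + (g x * indicator C x * ?p + f x * indicator C x * ?n) \<partial>M)"
    by (subst nn_integral_add; simp add: nn_integral_add nn_integral_multc C)
  also have "\<dots> = (\<integral>\<^sup>+x. (bregman (f x) (g x) + bregman (g x) (h x))
      + (f x * indicator C x * ?p + g x * indicator C x * ?n) \<partial>M)"
  proof (intro nn_integral_cong_AE, use fin AE_space in eventually_elim, goal_cases)
    case (1 x)
    then show ?case
    proof (cases "x \<in> C")
      case True
      then show ?thesis
        using bregman_pythagoras_pointwise[of "f x" c d] 1 cd g[of x] h[of x] by simp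
    next
      case False
      then show ?thesis using outside[of x] 1 by (simp add: bregman_refl)
    qed
  qed
  also have "\<dots> = ((\<integral>\<^sup>+x. bregman (f x) (g x) \<partial>M) + (\<integral>\<^sup>+x. bregman (g x) (h x) \<partial>M))
      + (?F * ?p + ?F * ?n)"
    by (simp add: nn_integral_add nn_integral_multc C)
  finally show ?thesis
    using F ennreal_add_left_cancel[of "?F * ?p + ?F * ?n"]
    by (auto simp: ennreal_mult_eq_top_iff ac_simps)
qed

section \<open>Uniform mixtures, and integration against endpoint mixtures\<close>

lemma Unif_eq: "Unif u x = (if 0 \<le> x \<and> x \<le> u then inverse (ennreal u) else 0)"
  by (auto simp: Unif_def divide_ennreal_def indicator_def)

lemma measurable_Unif [measurable]:
  assumes [measurable]: "f \<in> borel_measurable M" "g \<in> borel_measurable M"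
  shows "(\<lambda>x. Unif (f x) (g x)) \<in> borel_measurable M"
  unfolding Unif_eq by measurable

lemma measurable_unif_mixture [measurable]:
  assumes "sigma_finite_measure P" and [measurable_cong]: "sets P = sets borel"
    and [measurable]: "S \<in> sets borel"
  shows "unif_mixture S P \<in> borel_measurable borel"
proof -
  interpret sigma_finite_measure P by fact
  have "(\<lambda>x. \<integral>\<^sup>+u. Unif u x * indicator S u \<partial>P) \<in> borel_measurable borel"
    by measurable
  then show ?thesis by (simp add: unif_mixture_def[abs_def])
qed

lemma nn_integral_Unif:
  assumes [measurable]: "A \<in> sets borel"
  shows "(\<integral>\<^sup>+x\<in>A. Unif u x \<partial>lborel) = emeasure lborel ({0..u} \<inter> A) / ennreal u"
proof -
  have "(\<integral>\<^sup>+x\<in>A. Unif u x \<partial>lborel) = (\<integral>\<^sup>+x. indicator ({0..u} \<inter> A) x / ennreal u \<partial>lborel)"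
    by (intro nn_integral_cong) (auto simp: Unif_def indicator_def)
  then show ?thesis by (simp add: nn_integral_divide)
qed

text \<open>Tonelli: integrating the kernel over x first leaves the length of
  \<open>{0..u} \<inter> A\<close> divided by u. Different A later yield total masses and the
  distribution function at L.\<close>

lemma nn_integral_unif_mixture:
  assumes P: "sigma_finite_measure P" and sP [measurable_cong]: "sets P = sets borel"
    and [measurable]: "S \<in> sets borel" "A \<in> sets borel"
  shows "(\<integral>\<^sup>+x\<in>A. unif_mixture S P x \<partial>lborel)
       = (\<integral>\<^sup>+u\<in>S. emeasure lborel ({0..u} \<inter> A) / ennreal u \<partial>P)"
proof -
  interpret sigma_finite_measure P by fact
  interpret pair_sigma_finite P lborel ..
  have "(\<integral>\<^sup>+x\<in>A. unif_mixture S P x \<partial>lborel)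
      = (\<integral>\<^sup>+x. (\<integral>\<^sup>+u. Unif u x * indicator S u * indicator A x \<partial>P) \<partial>lborel)"
    unfolding unif_mixture_def by (intro nn_integral_cong nn_integral_multc[symmetric]) measurable
  also have "\<dots> = (\<integral>\<^sup>+u. (\<integral>\<^sup>+x. Unif u x * indicator S u * indicator A x \<partial>lborel) \<partial>P)"
    by (intro Fubini') measurable
  also have "\<dots> = (\<integral>\<^sup>+u. (\<integral>\<^sup>+x. Unif u x * indicator A x * indicator S u \<partial>lborel) \<partial>P)"
    by (simp add: ac_simps)
  also have "\<dots> = (\<integral>\<^sup>+u\<in>S. emeasure lborel ({0..u} \<inter> A) / ennreal u \<partial>P)"
    by (intro nn_integral_cong) (simp add: nn_integral_multc nn_integral_Unif)
  finally show ?thesis .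
qed

text \<open>The mixture is given by its values on sets, so the integral formula is carried from
  indicators to all Borel functions by linearity and monotone limits.\<close>

lemma nn_integral_endpoint_mixture:
  assumes sQ [measurable_cong]: "sets Q = sets borel" and f: "f \<in> borel_measurable borel"
  shows "(\<integral>\<^sup>+x. f x \<partial>endpoint_mixture a l b Q c L) = a * f l + b * (\<integral>\<^sup>+x. f x \<partial>Q) + c * f L"
  using f
proof (induction rule: borel_measurable_induct)
  case (cong f g)
  then show ?case by simp
next
  case (set A)
  then show ?case using sQ by (simp add: emeasure_endpoint_mixture)
next
  case (mult u r)
  then have [measurable]: "u \<in> borel_measurable borel" by simp
  have "u \<in> borel_measurable (endpoint_mixture a l b Q c L)"
    by (simp add: measurable_cong_sets[OF sets_endpoint_mixture refl])
  then show ?case using mult by (simp add: nn_integral_cmult algebra_simps)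
next
  case (add u v)
  then have [measurable]: "u \<in> borel_measurable borel" "v \<in> borel_measurable borel" by simp_all
  have "u \<in> borel_measurable (endpoint_mixture a l b Q c L)" "v \<in> borel_measurable (endpoint_mixture a l b Q c L)"
    by (simp_all add: measurable_cong_sets[OF sets_endpoint_mixture refl])
  then show ?case using add by (simp add: nn_integral_add algebra_simps)
next
  case (seq U)
  then have [measurable]: "\<And>i. U i \<in> borel_measurable borel" by simp
  have m: "\<And>i. U i \<in> borel_measurable (endpoint_mixture a l b Q c L)"
    by (simp add: measurable_cong_sets[OF sets_endpoint_mixture refl])
  have inc: "incseq (\<lambda>i. U i x)" for x
    using seq.hyps by (auto simp: incseq_def le_fun_def)
  have incQ: "incseq (\<lambda>i. \<integral>\<^sup>+x. U i x \<partial>Q)"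
    using seq.hyps by (auto simp: incseq_def le_fun_def intro!: nn_integral_mono)
  have incm: "incseq (\<lambda>i. k * F i)" if "incseq F" for k :: ennreal and F
    using that by (auto simp: incseq_def intro!: mult_left_mono)
  have incp: "incseq (\<lambda>i. F i + G i)" if "incseq F" "incseq G" for F G :: "nat \<Rightarrow> ennreal"
    using that by (auto simp: incseq_def intro!: add_mono)
  have "(\<integral>\<^sup>+x. (SUP i. U i) x \<partial>endpoint_mixture a l b Q c L)
      = (SUP i. a * U i l + b * (\<integral>\<^sup>+x. U i x \<partial>Q) + c * U i L)"
    using seq m by (simp add: image_comp nn_integral_monotone_convergence_SUP)
  also have "\<dots> = a * (SUP i. U i l) + b * (SUP i. (\<integral>\<^sup>+x. U i x \<partial>Q)) + c * (SUP i. U i L)"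
    unfolding SUP_mult_left_ennreal
    by (subst ennreal_SUP_add, (intro incm incp inc incQ)+)+ (rule refl)
  also have "(SUP i. (\<integral>\<^sup>+x. U i x \<partial>Q)) = (\<integral>\<^sup>+x. (SUP i. U i x) \<partial>Q)"
    using seq.hyps by (intro nn_integral_monotone_convergence_SUP[symmetric]) auto
  finally show ?case by (simp only: SUP_apply)
qed

section \<open>Identifiability of the mixing measure\<close>

definition kernel_density :: "real set \<Rightarrow> real measure \<Rightarrow> real measure" where
  "kernel_density S P = density P (\<lambda>u. inverse (ennreal u) * indicator S u)"

text \<open>For x \<ge> 0 the kernel \<open>Unif u x\<close> is 1 / u times the indicator of u \<ge>
  x, so integration over u produces a tail.\<close>

lemma unif_mixture_eq_tail:
  assumes sP [measurable_cong]: "sets P = sets borel" and [measurable]: "S \<in> sets borel" and "0 \<le> x"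
  shows "unif_mixture S P x = emeasure (kernel_density S P) {x..}"
  unfolding unif_mixture_def kernel_density_def using \<open>0 \<le> x\<close>
  by (subst emeasure_density) (auto intro!: nn_integral_cong simp: Unif_eq indicator_def)

text \<open>The open tail at x is the increasing union of the closed tails at x + 1 / (n + 1). The
  interval between x and such a point has positive length, so it contains a y at which the closed
  tails agree, and monotonicity on both sides of y gives the bound.\<close>

lemma emeasure_greaterThan_le_of_AE_tail:
  fixes \<mu> \<nu> :: "real measure"
  assumes s: "sets \<mu> = sets borel" "sets \<nu> = sets borel"
    and ae: "AE y in lborel. 0 < y \<longrightarrow> emeasure \<mu> {y..} = emeasure \<nu> {y..}" and x: "0 \<le> x"
  shows "emeasure \<mu> {x<..} \<le> emeasure \<nu> {x<..}"
proof -
  have U: "{x<..} = (\<Union>n. {x + inverse (real (Suc n))..})"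
  proof (intro set_eqI iffI)
    fix y assume "y \<in> {x<..}"
    then obtain n where "inverse (real (Suc n)) < y - x"
      using reals_Archimedean[of "y - x"] by auto
    then have "y \<in> {x + inverse (real (Suc n))..}" by (simp del: of_nat_Suc)
    then show "y \<in> (\<Union>n. {x + inverse (real (Suc n))..})" by blast
  next
    fix y assume "y \<in> (\<Union>n. {x + inverse (real (Suc n))..})"
    then obtain n where "x + inverse (real (Suc n)) \<le> y" by auto
    moreover have "0 < inverse (real (Suc n))" by simp
    ultimately have "x < y" by linarith
    then show "y \<in> {x<..}" by simp
  qed
  have "emeasure \<mu> {x<..} = (SUP n. emeasure \<mu> {x + inverse (real (Suc n))..})"
    unfolding U
  proof (rule SUP_emeasure_incseq[symmetric])
    have "x + inverse (real (Suc j)) \<le> x + inverse (real (Suc i))" if "i \<le> j" for i j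
      using that by (intro add_left_mono le_imp_inverse_le) auto
    then show "incseq (\<lambda>n. {x + inverse (real (Suc n))..})"
      unfolding incseq_def atLeast_subset_iff by blast
    show "range (\<lambda>n. {x + inverse (real (Suc n))..}) \<subseteq> sets \<mu>"
      by (intro image_subsetI) (simp add: s(1))
  qed
  also have "\<dots> \<le> emeasure \<nu> {x<..}"
  proof (rule SUP_least)
    fix n
    let ?e = "inverse (real (Suc n))"
    have "\<exists>y\<in>{x<..<x + ?e}. 0 < y \<longrightarrow> emeasure \<mu> {y..} = emeasure \<nu> {y..}"
    proof (rule ccontr)
      assume "\<not> ?thesis"
      then have "AE y in lborel. y \<notin> {x<..<x + ?e}"
        using ae by (auto elim!: eventually_mono)
      then have "emeasure lborel {x<..<x + ?e} = 0"
        by (subst (asm) AE_iff_measurable[of "{x<..<x + ?e}"]) auto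
      moreover have "emeasure lborel {x<..<x + ?e} = ennreal ?e" by (subst emeasure_lborel_Ioo) auto
      moreover have "0 < ?e" by simp
      ultimately show False by (simp only: ennreal_eq_0_iff)
    qed
    then obtain y where y: "x < y" "y < x + ?e" "emeasure \<mu> {y..} = emeasure \<nu> {y..}" using x by auto
    have "emeasure \<mu> {x + ?e..} \<le> emeasure \<mu> {y..}" using y s by (intro emeasure_mono) auto
    also have "\<dots> \<le> emeasure \<nu> {x<..}" unfolding y(3) using y s by (intro emeasure_mono) auto
    finally show "emeasure \<mu> {x + ?e..} \<le> emeasure \<nu> {x<..}" .
  qed
  finally show ?thesis .
qed

text \<open>Almost everywhere equal mixtures give equal open tails of the two measures P(du) / u and
  Q(du) / u. Tails determine these finite measures, and the density u turns them back into P and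
  Q.\<close>

lemma unif_mixture_inject_AE:
  assumes P: "prob_measure_on {l..L} P" and Q: "prob_measure_on {l..L} Q" and l: "0 < l"
    and ae: "AE x in lborel. unif_mixture {l..L} P x = unif_mixture {l..L} Q x"
  shows "P = Q"
proof -
  let ?\<nu> = "kernel_density {l..L}"
  have sets: "sets P = sets borel" "sets Q = sets borel"
    using P Q by (auto simp: prob_measure_on_def)
  have s\<nu>: "sets (?\<nu> R) = sets borel" if "sets R = sets borel" for R
    using that by (simp add: kernel_density_def)
  have dens: "emeasure (?\<nu> R) A = (\<integral>\<^sup>+u. inverse (ennreal u) * indicator {l..L} u * indicator A u \<partial>R)"
    if [measurable_cong]: "sets R = sets borel" and [measurable]: "A \<in> sets borel" for R A
    unfolding kernel_density_def by (rule emeasure_density) measurable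
  \<comment> \<open>The measure lives on \<open>{l..L}\<close> with l > 0, so a tail from a negative
    point equals the tail from 0.\<close>
  have low: "emeasure (?\<nu> R) {x<..} = emeasure (?\<nu> R) {0<..}" if "sets R = sets borel" "x < 0" for R x
  proof -
    have "indicator {l..L} u * indicator {x<..} u = (indicator {l..L} u * indicator {0<..} u :: ennreal)" for u
      using that l by (auto simp: indicator_def)
    then show ?thesis using that(1) by (simp add: dens mult.assoc)
  qed
  have ae': "AE y in lborel. 0 < y \<longrightarrow> emeasure (?\<nu> P) {y..} = emeasure (?\<nu> Q) {y..}"
    using ae by eventually_elim (auto simp: unif_mixture_eq_tail[symmetric] sets)
  have eq: "emeasure (?\<nu> P) {x<..} = emeasure (?\<nu> Q) {x<..}" if "0 \<le> x" for x
  proof (rule antisym; rule emeasure_greaterThan_le_of_AE_tail[OF _ _ _ that])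
    show "AE y in lborel. 0 < y \<longrightarrow> emeasure (?\<nu> Q) {y..} = emeasure (?\<nu> P) {y..}"
      using ae' by eventually_elim simp
  qed (use ae' s\<nu> sets in simp_all)
  \<comment> \<open>\<open>measure_eqI_lessThan\<close> asks for finite tails; 1 / u \<le> 1 / l
    bounds the total mass.\<close>
  have fin: "emeasure (?\<nu> P) A < \<infinity>" for A
  proof -
    interpret prob_space P using P by (simp add: prob_measure_on_def)
    have "emeasure (?\<nu> P) A \<le> emeasure (?\<nu> P) UNIV"
      by (metis emeasure_space sets_eq_imp_space_eq s\<nu> sets(1) space_borel)
    also have "\<dots> = (\<integral>\<^sup>+u\<in>{l..L}. inverse (ennreal u) \<partial>P)"
      using sets by (simp add: dens)
    also have "\<dots> \<le> (\<integral>\<^sup>+u. inverse (ennreal l) \<partial>P)"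
      using l by (intro nn_integral_mono) (auto simp: indicator_def inverse_ennreal intro!: ennreal_leI le_imp_inverse_le)
    also have "\<dots> < \<infinity>" using l by (simp add: emeasure_space_1 inverse_ennreal)
    finally show ?thesis .
  qed
  have \<nu>: "?\<nu> P = ?\<nu> Q"
  proof (rule measure_eqI_lessThan)
    show "emeasure (?\<nu> P) {x<..} = emeasure (?\<nu> Q) {x<..}" for x
      using eq[of x] eq[of 0] low[of P x] low[of Q x] sets by (cases "0 \<le> x") auto
  qed (use fin s\<nu> sets in auto)
  \<comment> \<open>Multiplying by u undoes the factor 1 / u, since almost every u lies in
    \<open>{l..L}\<close> and is therefore positive.\<close>
  have inv: "density (?\<nu> R) ennreal = R" if "prob_measure_on {l..L} R" for R
  proof -
    have [measurable_cong]: "sets R = sets borel" and z: "emeasure R (- {l..L}) = 0"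
      using that by (auto simp: prob_measure_on_def)
    have "AE u in R. u \<in> {l..L}"
      using z by (intro AE_I[of _ _ "- {l..L}"]) (auto simp: \<open>sets R = sets borel\<close>)
    then have one: "AE u in R. inverse (ennreal u) * indicator {l..L} u * ennreal u = 1"
    proof eventually_elim
      case (elim u)
      then show ?case using l by (simp add: inverse_ennreal ennreal_mult[symmetric])
    qed
    have "density (?\<nu> R) ennreal = density R (\<lambda>u. inverse (ennreal u) * indicator {l..L} u * ennreal u)"
      unfolding kernel_density_def by (rule density_density_eq; measurable)
    also have "\<dots> = density R (\<lambda>_. 1)"
      by (rule density_cong[OF _ _ one]; measurable)
    finally have "density (?\<nu> R) ennreal = density R (\<lambda>_. 1)" .
    then show ?thesis by (simp add: density_1)
  qed
  show ?thesis by (metis \<nu> inv[OF P] inv[OF Q])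
qed

section \<open>Mixtures over probability measures on \<open>{l..L}\<close>\<close>

lemma ennreal_mult_inverse: "0 < u \<Longrightarrow> ennreal u * inverse (ennreal u) = 1"
  by (simp add: inverse_ennreal ennreal_mult[symmetric])

text \<open>For u in \<open>{l..L}\<close> the kernel has mass 1 and equals 1 / u on all of
  \<open>{0..l}\<close>. The constant value there is thus the mean of 1 / u, which is positive and
  at most 1 / l.\<close>

lemma unif_mixture_prob:
  assumes P: "prob_measure_on {l..L} P" and l: "0 < l"
  shows measurable_unif_mixture_prob: "unif_mixture {l..L} P \<in> borel_measurable borel"
    and nn_integral_unif_mixture_prob: "(\<integral>\<^sup>+x. unif_mixture {l..L} P x \<partial>lborel) = 1"
    and unif_mixture_const: "\<And>x. x \<in> {0..l} \<Longrightarrow> unif_mixture {l..L} P x = unif_mixture {l..L} P 0"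
    and unif_mixture_0_pos: "0 < unif_mixture {l..L} P 0"
    and unif_mixture_0_finite: "unif_mixture {l..L} P 0 < \<infinity>"
proof -
  interpret prob_space P using P by (simp add: prob_measure_on_def)
  have sP [measurable_cong]: "sets P = sets borel" and z: "emeasure P (- {l..L}) = 0"
    using P by (auto simp: prob_measure_on_def)
  have ae: "AE u in P. u \<in> {l..L}"
    using z by (intro AE_I[of _ _ "- {l..L}"]) (auto simp: sP)
  have sf: "sigma_finite_measure P" ..
  show "unif_mixture {l..L} P \<in> borel_measurable borel"
    by (intro measurable_unif_mixture sf sP) simp
  show "\<And>x. x \<in> {0..l} \<Longrightarrow> unif_mixture {l..L} P x = unif_mixture {l..L} P 0"
    using l unfolding unif_mixture_def by (intro nn_integral_cong) (auto simp: Unif_eq indicator_def)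
  have "(\<integral>\<^sup>+x. unif_mixture {l..L} P x \<partial>lborel) = (\<integral>\<^sup>+u\<in>{l..L}. emeasure lborel {0..u} / ennreal u \<partial>P)"
    using nn_integral_unif_mixture[OF sf sP, of "{l..L}" UNIV] by simp
  also have "\<dots> = (\<integral>\<^sup>+u. 1 \<partial>P)"
    using ae l by (intro nn_integral_cong_AE, elim eventually_mono) (auto simp: divide_ennreal)
  finally show "(\<integral>\<^sup>+x. unif_mixture {l..L} P x \<partial>lborel) = 1" by (simp add: emeasure_space_1)
  have "unif_mixture {l..L} P 0 \<le> (\<integral>\<^sup>+u. inverse (ennreal l) \<partial>P)"
    unfolding unif_mixture_def using l
    by (intro nn_integral_mono) (auto simp: Unif_eq indicator_def inverse_ennreal intro!: ennreal_leI le_imp_inverse_le)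
  also have "\<dots> < \<infinity>" using l by (simp add: emeasure_space_1 inverse_ennreal)
  finally show "unif_mixture {l..L} P 0 < \<infinity>" .
  have "\<not> unif_mixture {l..L} P 0 = 0"
  proof
    assume "unif_mixture {l..L} P 0 = 0"
    then have "AE u in P. Unif u 0 * indicator {l..L} u = 0"
      unfolding unif_mixture_def by (subst (asm) nn_integral_0_iff_AE) measurable
    with ae have "AE u in P. False"
    proof eventually_elim
      case (elim u)
      then show ?case using l by (simp add: Unif_eq inverse_ennreal)
    qed
    then show False by simp
  qed
  then show "0 < unif_mixture {l..L} P 0" by (simp add: zero_less_iff_neq_zero)
qed

section \<open>The truncated density and the candidate minimizer\<close>

locale mixture_truncation =
  fixes m :: "real \<Rightarrow> ennreal" and Pstar :: "real measure" and l L :: real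
  assumes dens: "prob_density_on {0..} m"
    and Pstar: "prob_measure_on {0..} Pstar"
    and repr: "\<And>x. 0 \<le> x \<Longrightarrow> m x = unif_mixture {0..} Pstar x"
    and lL: "0 < l" "l < L"
begin

sublocale prob_space Pstar using Pstar by (simp add: prob_measure_on_def)

lemma sets_Pstar [measurable_cong]: "sets Pstar = sets borel"
  using Pstar by (simp add: prob_measure_on_def)

abbreviation M :: ennreal where "M \<equiv> distr_fun m L"

definition projection :: "real measure" where
  "projection = endpoint_mixture (emeasure Pstar {0..l} / M) l (emeasure Pstar {0..L} / M)
     (restr Pstar l L) (ennreal L * m L / M) L"

lemma nn_integral_m:
  assumes [measurable]: "A \<in> sets borel" and A: "A \<subseteq> {0..}"
  shows "(\<integral>\<^sup>+x\<in>A. m x \<partial>lborel) = (\<integral>\<^sup>+u\<in>{0..}. emeasure lborel ({0..u} \<inter> A) / ennreal u \<partial>Pstar)"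
proof -
  have "(\<integral>\<^sup>+x\<in>A. m x \<partial>lborel) = (\<integral>\<^sup>+x\<in>A. unif_mixture {0..} Pstar x \<partial>lborel)"
    using A by (intro nn_integral_cong) (auto simp: repr indicator_def)
  also have "\<dots> = (\<integral>\<^sup>+u\<in>{0..}. emeasure lborel ({0..u} \<inter> A) / ennreal u \<partial>Pstar)"
    by (rule nn_integral_unif_mixture) (auto simp: sets_Pstar sigma_finite_measure_axioms)
  finally show ?thesis .
qed

text \<open>An atom at 0 would contribute nothing to the mass of m: the interval
  \<open>{0..0}\<close> has length 0, and 0 / 0 = 0 in \<open>ennreal\<close>. Since m has mass 1,
  all mass of \<open>Pstar\<close> sits on \<open>{0<..}\<close>.\<close>

lemma AE_Pstar_pos: "AE u in Pstar. 0 < u"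
proof -
  have "1 = (\<integral>\<^sup>+u\<in>{0..}. emeasure lborel ({0..u} \<inter> {0..}) / ennreal u \<partial>Pstar)"
    using dens nn_integral_m[of "{0..}"] by (simp add: prob_density_on_def)
  also have "\<dots> = (\<integral>\<^sup>+u. indicator {0<..} u \<partial>Pstar)"
    by (intro nn_integral_cong) (auto simp: indicator_def Int_absorb2 divide_ennreal)
  also have "\<dots> = emeasure Pstar {0<..}" by (simp add: sets_Pstar)
  finally have "prob {0<..} = 1" by (simp add: emeasure_eq_measure)
  then have "AE u in Pstar. u \<in> {0<..}" by (rule AE_prob_1)
  then show ?thesis by simp
qed

lemma m_eq_nn_integral: "0 \<le> x \<Longrightarrow> m x = (\<integral>\<^sup>+u. Unif u x * indicator {0..} u \<partial>Pstar)"
  by (simp add: repr unif_mixture_def)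

text \<open>The kernel at u > 0 has mass min u L / u on \<open>{0..L}\<close>. This is 1 for u < L
  and L * \<open>Unif u L\<close> for u \<ge> L, so an atom at L is counted in the second
  term.\<close>

lemma M_eq: "M = emeasure Pstar {0<..<L} + ennreal L * m L"
proof -
  have "M = (\<integral>\<^sup>+u\<in>{0..}. emeasure lborel ({0..u} \<inter> {0..L}) / ennreal u \<partial>Pstar)"
    unfolding distr_fun_def by (rule nn_integral_m) auto
  also have "\<dots> = (\<integral>\<^sup>+u. indicator {0<..<L} u + ennreal L * (Unif u L * indicator {0..} u) \<partial>Pstar)"
  proof (rule nn_integral_cong)
    fix u
    have "{0..u} \<inter> {0..L} = {0..min u L}" by auto
    then show "emeasure lborel ({0..u} \<inter> {0..L}) / ennreal u * indicator {0..} u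
      = indicator {0<..<L} u + ennreal L * (Unif u L * indicator {0..} u)"
      using lL by (auto simp: indicator_def Unif_eq divide_ennreal_def min_def ennreal_mult_inverse)
  qed
  also have "\<dots> = emeasure Pstar {0<..<L} + ennreal L * m L"
    using lL by (simp add: nn_integral_add nn_integral_cmult m_eq_nn_integral sets_Pstar)
  finally show ?thesis .
qed

text \<open>If both terms of \<open>M_eq\<close> vanished, \<open>Pstar\<close> would charge neither
  \<open>{0<..<L}\<close> nor, as \<open>Unif u L\<close> is positive for u \<ge> L, the set
  \<open>{L..}\<close>. By \<open>AE_Pstar_pos\<close> nothing else is left.\<close>

lemma M_pos: "0 < M"
proof (rule ccontr)
  assume "\<not> 0 < M"
  then have "emeasure Pstar {0<..<L} = 0" "m L = 0"
    using lL M_eq by (auto simp: ennreal_eq_0_iff)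
  then have "AE u in Pstar. u \<notin> {0<..<L}"
    by (intro AE_I[of _ _ "{0<..<L}"]) (auto simp: sets_Pstar)
  moreover have "AE u in Pstar. Unif u L * indicator {0..} u = 0"
    using \<open>m L = 0\<close> lL unfolding m_eq_nn_integral[OF less_imp_le[OF less_trans[OF lL]]]
    by (subst (asm) nn_integral_0_iff_AE) measurable
  ultimately have "AE u in Pstar. False" using AE_Pstar_pos
  proof eventually_elim
    case (elim u)
    then show ?case using lL by (auto simp: Unif_eq inverse_ennreal indicator_def split: if_splits)
  qed
  then show False by simp
qed

lemma M_le_1: "M \<le> 1"
proof -
  have "M \<le> (\<integral>\<^sup>+x\<in>{0..}. m x \<partial>lborel)"
    unfolding distr_fun_def by (intro nn_integral_mono) (auto simp: indicator_def)
  then show ?thesis using dens by (simp add: prob_density_on_def)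
qed

lemma divide_M_self: "M / M = 1"
  using M_pos le_less_trans[OF M_le_1 ennreal_one_less_top] by (intro ennreal_divide_self) auto

text \<open>The factor \<open>emeasure Pstar {0..L}\<close> cancels the normalization inside
  \<open>restr\<close>. When it is 0 no cancellation is possible, but both sides are 0.\<close>

lemma nn_integral_restr:
  assumes [measurable]: "f \<in> borel_measurable borel"
  shows "emeasure Pstar {0..L} / M * (\<integral>\<^sup>+u. f u \<partial>restr Pstar l L) = (\<integral>\<^sup>+u\<in>{l<..<L}. f u \<partial>Pstar) / M"
proof -
  let ?I = "\<integral>\<^sup>+u\<in>{l<..<L}. f u \<partial>Pstar" and ?p = "emeasure Pstar {0..L}"
  have "(\<integral>\<^sup>+u. f u \<partial>restr Pstar l L) = (\<integral>\<^sup>+u. indicator {l<..<L} u * f u \<partial>uniform_measure Pstar {0..L})"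
    unfolding restr_def by (rule nn_integral_density) measurable
  also have "\<dots> = (\<integral>\<^sup>+u. indicator {l<..<L} u * f u * indicator {0..L} u \<partial>Pstar) / ?p"
    by (rule nn_integral_uniform_measure) measurable
  also have "(\<integral>\<^sup>+u. indicator {l<..<L} u * f u * indicator {0..L} u \<partial>Pstar) = ?I"
    using lL by (intro nn_integral_cong) (auto simp: indicator_def)
  finally have eq: "(\<integral>\<^sup>+u. f u \<partial>restr Pstar l L) = ?I / ?p" .
  show ?thesis
  proof (cases "?p = 0")
    case True
    then have "AE u in Pstar. u \<notin> {0..L}"
      by (intro AE_I[of _ _ "{0..L}"]) (auto simp: sets_Pstar)
    then have "?I = (\<integral>\<^sup>+u. 0 \<partial>Pstar)"
      using lL by (intro nn_integral_cong_AE, elim eventually_mono) (auto simp: indicator_def)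
    then show ?thesis using True by simp
  next
    case False
    have "?p / M * (?I / ?p) = (?p / ?p) * (?I / M)"
      by (simp add: divide_ennreal_def ac_simps)
    also have "?p / ?p = 1" using False by (intro ennreal_divide_self) (auto simp: emeasure_eq_measure)
    finally show ?thesis by (simp add: eq)
  qed
qed

lemma nn_integral_projection:
  assumes [measurable]: "f \<in> borel_measurable borel"
  shows "(\<integral>\<^sup>+u. f u \<partial>projection)
    = (emeasure Pstar {0..l} * f l + (\<integral>\<^sup>+u\<in>{l<..<L}. f u \<partial>Pstar) + ennreal L * m L * f L) / M"
  unfolding projection_def
  by (simp add: nn_integral_endpoint_mixture sets_Pstar nn_integral_restr)
    (simp add: divide_ennreal_def algebra_simps)

lemma sets_projection [simp, measurable_cong]: "sets projection = sets borel"
  by (simp add: projection_def)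

lemma emeasure_projection:
  assumes [measurable]: "A \<in> sets borel"
  shows "emeasure projection A
    = (emeasure Pstar {0..l} * indicator A l + emeasure Pstar ({l<..<L} \<inter> A) + ennreal L * m L * indicator A L) / M"
proof -
  have "(\<integral>\<^sup>+u\<in>{l<..<L}. indicator A u \<partial>Pstar) = emeasure Pstar ({l<..<L} \<inter> A)"
    using nn_integral_indicator[of "{l<..<L} \<inter> A" Pstar]
    by (simp add: indicator_inter_arith mult.commute sets_Pstar)
  then show ?thesis using nn_integral_projection[of "indicator A"] by simp
qed

text \<open>As \<open>Pstar\<close> has no mass at 0, the masses of \<open>{0..l}\<close> and
  \<open>{l<..<L}\<close> add up to that of \<open>{0<..<L}\<close>. With the weight at L the
  numerator becomes the right-hand side of \<open>M_eq\<close>.\<close>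

lemma prob_measure_on_projection: "prob_measure_on {l..L} projection"
proof -
  have sp: "space projection = UNIV"
    using sets_eq_imp_space_eq[OF sets_projection] by simp
  have "emeasure Pstar {0<..<L} = emeasure Pstar ({0..l} \<union> {l<..<L})"
    by (intro emeasure_eq_AE, use AE_Pstar_pos in eventually_elim) (use lL in \<open>auto simp: sets_Pstar\<close>)
  also have "\<dots> = emeasure Pstar {0..l} + emeasure Pstar {l<..<L}"
    by (intro plus_emeasure[symmetric]) (auto simp: sets_Pstar)
  finally have "emeasure projection UNIV = 1"
    using divide_M_self M_eq by (simp add: emeasure_projection)
  moreover have "{l<..<L} \<inter> - {l..L} = {}" by auto
  ultimately show ?thesis
    unfolding prob_measure_on_def using lL
    by (auto intro!: prob_spaceI simp: sp emeasure_projection)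
qed

text \<open>For l < x \<le> L only kernels with u \<ge> x contribute to m x. Those with u \<ge> L
  take the same value at x as at L and sum to m L, which is what the atom at L supplies; the others
  form the restricted part, and the atom at l contributes 0. Outside \<open>{0..L}\<close> both
  sides vanish.\<close>

lemma truncated_eq_unif_mixture_projection:
  assumes "x \<notin> {0..l}"
  shows "truncated m L x = unif_mixture {l..L} projection x"
proof (cases "x \<in> {l<..L}")
  case True
  have "m x = (\<integral>\<^sup>+u. Unif u x * indicator {l..L} u * indicator {l<..<L} u + Unif u L * indicator {0..} u \<partial>Pstar)"
    using True lL by (subst m_eq_nn_integral) (auto intro!: nn_integral_cong simp: Unif_eq indicator_def)
  also have "\<dots> = (\<integral>\<^sup>+u\<in>{l<..<L}. Unif u x * indicator {l..L} u \<partial>Pstar) + m L"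
    using lL by (simp add: nn_integral_add m_eq_nn_integral)
  finally have "m x = (\<integral>\<^sup>+u\<in>{l<..<L}. Unif u x * indicator {l..L} u \<partial>Pstar) + m L" .
  moreover have "ennreal L * inverse (ennreal L) = 1"
    using lL by (simp add: inverse_ennreal ennreal_mult[symmetric])
  then have "ennreal L * m L * Unif L x = m L"
    using True lL by (simp add: Unif_eq mult.assoc mult.left_commute[of "ennreal L"])
  ultimately show ?thesis
    unfolding unif_mixture_def using True lL
    by (subst nn_integral_projection) (auto simp: truncated_def Unif_eq)
next
  case False
  then have "(\<lambda>u. Unif u x * indicator {l..L} u) = (\<lambda>_. 0)" and "x \<notin> {0..L}"
    using assms by (auto simp: Unif_eq indicator_def)
  then show ?thesis
    by (simp add: truncated_def unif_mixture_def)
qed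

lemma truncated_density:
  shows measurable_truncated: "truncated m L \<in> borel_measurable borel"
    and nn_integral_truncated: "(\<integral>\<^sup>+x. truncated m L x \<partial>lborel) = 1"
proof -
  have [measurable]: "(\<lambda>x. m x * indicator {0..} x) \<in> borel_measurable borel"
    using dens by (simp add: prob_density_on_def)
  \<comment> \<open>The hypothesis gives measurability of m only after cutting off to
    \<open>{0..}\<close>, so the cut-off to \<open>{0..L}\<close> is reached through the product of
    both indicators.\<close>
  have "(\<lambda>x. m x * indicator {0..} x * indicator {0..L} x) \<in> borel_measurable borel"
    by measurable
  also have "(\<lambda>x. m x * indicator {0..} x * indicator {0..L} x) = (\<lambda>x. m x * indicator {0..L} x)"
    by (auto simp: indicator_def)
  finally have [measurable]: "(\<lambda>x. m x * indicator {0..L} x) \<in> borel_measurable borel" .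
  show "truncated m L \<in> borel_measurable borel"
    unfolding truncated_def[abs_def] by measurable
  show "(\<integral>\<^sup>+x. truncated m L x \<partial>lborel) = 1"
    using divide_M_self by (simp add: truncated_def nn_integral_divide distr_fun_def)
qed

section \<open>Decomposition of the divergence and the unique minimum\<close>

lemma KL_truncated:
  assumes P: "prob_measure_on {l..L} P"
  shows "KL (truncated m L) (unif_mixture {l..L} P)
    = enn2ereal ((\<integral>\<^sup>+x. bregman (truncated m L x) (unif_mixture {l..L} projection x) \<partial>lborel)
        + (\<integral>\<^sup>+x. bregman (unif_mixture {l..L} projection x) (unif_mixture {l..L} P x) \<partial>lborel))"
proof -
  let ?f = "truncated m L" and ?g = "unif_mixture {l..L} projection" and ?h = "unif_mixture {l..L} P"
  note G = unif_mixture_prob[OF prob_measure_on_projection lL(1)]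
  note H = unif_mixture_prob[OF P lL(1)]
  have [measurable]: "?f \<in> borel_measurable borel" "?g \<in> borel_measurable borel" "?h \<in> borel_measurable borel"
    using measurable_truncated G H by auto
  have split: "(\<integral>\<^sup>+x. k x \<partial>lborel) = (\<integral>\<^sup>+x\<in>{0..l}. k x \<partial>lborel) + (\<integral>\<^sup>+x\<in>- {0..l}. k x \<partial>lborel)"
    if [measurable]: "k \<in> borel_measurable borel" for k :: "real \<Rightarrow> ennreal"
    by (subst nn_integral_add[symmetric]) (auto intro!: nn_integral_cong simp: indicator_def)
  have out: "(\<integral>\<^sup>+x\<in>- {0..l}. ?f x \<partial>lborel) = (\<integral>\<^sup>+x\<in>- {0..l}. ?g x \<partial>lborel)"
    by (intro nn_integral_cong) (auto simp: truncated_eq_unif_mixture_projection indicator_def)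
  have "(\<integral>\<^sup>+x\<in>- {0..l}. ?g x \<partial>lborel) \<le> (\<integral>\<^sup>+x. ?g x \<partial>lborel)"
    by (intro nn_integral_mono) (auto simp: indicator_def)
  then have "(\<integral>\<^sup>+x\<in>- {0..l}. ?g x \<partial>lborel) \<noteq> \<infinity>"
    using G(2) by (auto simp: top_unique)
  moreover have "(\<integral>\<^sup>+x\<in>- {0..l}. ?g x \<partial>lborel) + (\<integral>\<^sup>+x\<in>{0..l}. ?f x \<partial>lborel) = 1"
    using split[of ?f] nn_integral_truncated by (simp add: out add.commute)
  moreover have "(\<integral>\<^sup>+x\<in>- {0..l}. ?g x \<partial>lborel) + (\<integral>\<^sup>+x\<in>{0..l}. ?g x \<partial>lborel) = 1"
    using split[of ?g] G(2) by (simp add: add.commute)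
  \<comment> \<open>Both functions have mass 1 and agree off \<open>{0..l}\<close>. Cancelling the
    finite common mass leaves equal masses on \<open>{0..l}\<close>, as
    \<open>bregman_pythagoras\<close> requires.\<close>
  ultimately have inside: "(\<integral>\<^sup>+x\<in>{0..l}. ?f x \<partial>lborel) = (\<integral>\<^sup>+x\<in>{0..l}. ?g x \<partial>lborel)"
    by (metis ennreal_add_left_cancel)
  obtain c where c: "?g 0 = ennreal c" "0 < c"
    using G(4,5) by (cases "?g 0") auto
  obtain d where d: "?h 0 = ennreal d" "0 < d"
    using H(4,5) by (cases "?h 0") auto
  have "KL ?f ?h = enn2ereal (\<integral>\<^sup>+x. bregman (?f x) (?h x) \<partial>lborel)"
    by (rule KL_eq_bregman) (use nn_integral_truncated H(2) in simp_all)
  also have "(\<integral>\<^sup>+x. bregman (?f x) (?h x) \<partial>lborel)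
      = (\<integral>\<^sup>+x. bregman (?f x) (?g x) \<partial>lborel) + (\<integral>\<^sup>+x. bregman (?g x) (?h x) \<partial>lborel)"
  proof (rule bregman_pythagoras[of _ _ _ _ "{0..l}" c d])
    show "?g x = ennreal c" "?h x = ennreal d" if "x \<in> {0..l}" for x
      using G(3)[OF that] H(3)[OF that] c d by auto
  qed (use inside nn_integral_truncated truncated_eq_unif_mixture_projection c d in auto)
  finally show ?thesis .
qed

text \<open>A nonnegative integrand with integral 0 vanishes almost everywhere, so the two mixtures
  agree almost everywhere and \<open>unif_mixture_inject_AE\<close> identifies the mixing
  measures.\<close>

lemma eq_projection_of_bregman_0:
  assumes P: "prob_measure_on {l..L} P"
    and z: "(\<integral>\<^sup>+x. bregman (unif_mixture {l..L} projection x) (unif_mixture {l..L} P x) \<partial>lborel) = 0"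
  shows "P = projection"
proof -
  note G = unif_mixture_prob[OF prob_measure_on_projection lL(1)]
  note H = unif_mixture_prob[OF P lL(1)]
  have [measurable]: "unif_mixture {l..L} projection \<in> borel_measurable borel"
    "unif_mixture {l..L} P \<in> borel_measurable borel"
    using G H by auto
  have "AE x in lborel. bregman (unif_mixture {l..L} projection x) (unif_mixture {l..L} P x) = 0"
    using z by (subst (asm) nn_integral_0_iff_AE) auto
  moreover have "AE x in lborel. unif_mixture {l..L} projection x < \<infinity>"
    by (intro AE_finite_of_nn_integral) (use G(2) in auto)
  moreover have "AE x in lborel. unif_mixture {l..L} P x < \<infinity>"
    by (intro AE_finite_of_nn_integral) (use H(2) in auto)
  ultimately have "AE x in lborel. unif_mixture {l..L} P x = unif_mixture {l..L} projection x"
    by eventually_elim (metis bregman_eq_0D)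
  then show ?thesis
    by (rule unif_mixture_inject_AE[OF P prob_measure_on_projection lL(1)])
qed

text \<open>By \<open>KL_truncated\<close> the objective is \<open>?b + ?D P\<close>, where
  \<open>?D projection = 0\<close>. Hence \<open>projection\<close> is a minimizer, and any other
  one has \<open>?D P = 0\<close> once \<open>?b\<close> can be cancelled.\<close>

lemma is_arg_min_KL_iff:
  assumes fin: "\<exists>P. prob_measure_on {l..L} P \<and> KL (truncated m L) (unif_mixture {l..L} P) < \<infinity>"
  shows "is_arg_min (\<lambda>P. KL (truncated m L) (unif_mixture {l..L} P)) (prob_measure_on {l..L}) P
    \<longleftrightarrow> P = projection"
proof -
  let ?K = "\<lambda>P. KL (truncated m L) (unif_mixture {l..L} P)"
  let ?b = "\<integral>\<^sup>+x. bregman (truncated m L x) (unif_mixture {l..L} projection x) \<partial>lborel"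
  let ?D = "\<lambda>P. \<integral>\<^sup>+x. bregman (unif_mixture {l..L} projection x) (unif_mixture {l..L} P x) \<partial>lborel"
  note G = unif_mixture_prob[OF prob_measure_on_projection lL(1)]
  have "AE x in lborel. unif_mixture {l..L} projection x < \<infinity>"
    by (intro AE_finite_of_nn_integral) (use G(1,2) in auto)
  then have "AE x in lborel. bregman (unif_mixture {l..L} projection x) (unif_mixture {l..L} projection x) = 0"
    by eventually_elim (rule bregman_refl)
  then have D0: "?D projection = 0"
    using nn_integral_cong_AE[of _ "\<lambda>_. 0" lborel] by simp
  have le: "?K projection \<le> ?K P" if "prob_measure_on {l..L} P" for P
    unfolding KL_truncated[OF that] KL_truncated[OF prob_measure_on_projection] D0
    by (simp add: less_eq_ennreal.rep_eq[symmetric])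
  obtain P0 where "prob_measure_on {l..L} P0" "?K P0 < \<infinity>" using fin by auto
  \<comment> \<open>\<open>?b\<close> is a summand of the finite divergence at P0.\<close>
  then have b: "?b \<noteq> \<infinity>"
    by (auto simp: KL_truncated)
  show ?thesis
  proof
    assume "is_arg_min ?K (prob_measure_on {l..L}) P"
    then have P: "prob_measure_on {l..L} P" and "\<not> ?K projection < ?K P"
      using prob_measure_on_projection by (auto simp: is_arg_min_def)
    then have "?b + ?D P \<le> ?b"
      unfolding KL_truncated[OF P] KL_truncated[OF prob_measure_on_projection] D0
      by (simp add: less_eq_ennreal.rep_eq[symmetric] not_less)
    then have "?D P = 0" using b ennreal_add_left_cancel_le[of ?b "?D P" 0] by simp
    then show "P = projection" by (rule eq_projection_of_bregman_0[OF P])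
  next
    assume "P = projection"
    then show "is_arg_min ?K (prob_measure_on {l..L}) P"
      using le prob_measure_on_projection by (auto simp: is_arg_min_def not_less)
  qed
qed

lemma unif_mixture_projection:
  "unif_mixture {l..L} projection x =
    emeasure Pstar {0..l} / M * Unif l x + emeasure Pstar {0..L} / M * unif_mixture {l..L} (restr Pstar l L) x
    + ennreal L * m L / M * Unif L x"
  unfolding unif_mixture_def projection_def using lL
  by (subst nn_integral_endpoint_mixture) (auto simp: sets_Pstar)

end

theorem lemma1:
  fixes m :: "real \<Rightarrow> ennreal" and Pstar :: "real measure" and l L :: real
    and a_l a_U a_L :: ennreal and Pdag :: "real measure"
  assumes dens: "prob_density_on {0..} m"
    and mono: "antimono_on {0..} m"
    and Pstar: "prob_measure_on {0..} Pstar"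
    and repr: "\<And>x. 0 \<le> x \<Longrightarrow> m x = unif_mixture {0..} Pstar x"
    and lL: "0 < l" "l < L"
    and fin: "\<exists>P. prob_measure_on {l..L} P \<and> KL (truncated m L) (unif_mixture {l..L} P) < \<infinity>"
    and a_l: "a_l = emeasure Pstar {0..l} / distr_fun m L"
    and a_U: "a_U = emeasure Pstar {0..L} / distr_fun m L"
    and a_L: "a_L = ennreal L * m L / distr_fun m L"
    and Pdag: "Pdag = endpoint_mixture a_l l a_U (restr Pstar l L) a_L L"
  shows "(\<forall>P. is_arg_min (\<lambda>P. KL (truncated m L) (unif_mixture {l..L} P))
                (prob_measure_on {l..L}) P \<longleftrightarrow> P = Pdag) \<and>
         (\<forall>g. is_arg_min (KL (truncated m L))
                (\<lambda>g. \<exists>P. prob_measure_on {l..L} P \<and> g = unif_mixture {l..L} P) g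
              \<longleftrightarrow> g = unif_mixture {l..L} Pdag) \<and>
         (\<forall>x\<in>{0..L}. unif_mixture {l..L} Pdag x =
            a_l * Unif l x + a_U * unif_mixture {l..L} (restr Pstar l L) x + a_L * Unif L x)"
proof -
  interpret mixture_truncation m Pstar l L
    using dens Pstar repr lL by unfold_locales auto
  have Pdag': "Pdag = projection"
    unfolding Pdag a_l a_U a_L projection_def ..
  note arg_min = is_arg_min_KL_iff[OF fin]
  \<comment> \<open>The objective depends on P only through its mixture, so the minimizing functions
    are exactly the mixtures of the minimizing measures.\<close>
  have "is_arg_min (KL (truncated m L)) (\<lambda>g. \<exists>P. prob_measure_on {l..L} P \<and> g = unif_mixture {l..L} P) g
      \<longleftrightarrow> (\<exists>P. g = unif_mixture {l..L} P \<and>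
        is_arg_min (\<lambda>P. KL (truncated m L) (unif_mixture {l..L} P)) (prob_measure_on {l..L}) P)" for g
    by (auto simp: is_arg_min_def)
  then show ?thesis
    using arg_min unif_mixture_projection by (simp add: Pdag' a_l a_U a_L)
qed

end
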